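(* For the unit price seat reservation problem with $k$ stations, no deterministic fair online algorithm has an online bounded ratio of more than $\frac{11}{k+7}$.
   Context: Unit price seat reservation: a train has $n$ seats and travels through stations $1,\dots,k$. Requests are intervals $[a,b)$ with integers $1\le a<b\le k$, arriving online; each request must be irrevocably either rejected or accepted and assigned to a seat such that no two intervals assigned to the same seat overlap. The goal is to maximize the number of accepted requests. An online algorithm is fair if it never rejects a request that could be placed on some seat given its current assignment. For a deterministic online algorithm $A$, $\textsc{Opt}_A$ denotes an offline algorithm that is optimal among offline algorithms whose solution on any input $I$ satisfies, for every prefix $I'$ of $I$, that it accepts at least $A(I')$ requests of $I'$; the online bounded ratio of $A$ is the supremum of all $c$ such that $A(I)\ge c\,\textsc{Opt}_A(I)$ for all input sequences $I$.
   Formalization: The train is assumed to have n ≥ 2 seats and k ≥ 2 stations: with one seat and k ≥ 5 every fair algorithm equals its offline bounded optimum, so its ratio is 1 > 11/(k+7); with no seats or one station the ratio is infinite. *)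

theory Defs
  imports "HOL-Library.Extended_Real"
begin

text \<open>A pair \<open>(a, b)\<close> is the request for the interval \<open>[a, b)\<close>; an input is a list of requests in order
  of arrival. A decision is \<open>None\<close> (reject) or \<open>Some p\<close> (accept on seat \<open>p\<close>), where the \<open>n\<close> seats are
  \<open>0, \<dots>, n - 1\<close>; a solution for an input is the list of decisions for its requests.\<close>

type_synonym request = "nat \<times> nat"
type_synonym decision = "nat option"

definition requests :: "nat \<Rightarrow> request set" where
  "requests k = {(a, b). 1 \<le> a \<and> a < b \<and> b \<le> k}"

definition inputs :: "nat \<Rightarrow> request list set" where
  "inputs k = lists (requests k)"

definition overlap :: "request \<Rightarrow> request \<Rightarrow> bool" where
  "overlap r s \<longleftrightarrow> {fst r..<snd r} \<inter> {fst s..<snd s} \<noteq> {}"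

definition valid_solution :: "nat \<Rightarrow> request list \<Rightarrow> decision list \<Rightarrow> bool" where
  "valid_solution n I S \<longleftrightarrow>
     length S = length I \<and>
     (\<forall>i < length I. \<forall>p. S ! i = Some p \<longrightarrow> p < n) \<and>
     (\<forall>i < length I. \<forall>j < length I. \<forall>p.
        i \<noteq> j \<and> S ! i = Some p \<and> S ! j = Some p \<longrightarrow> \<not> overlap (I ! i) (I ! j))"

definition num_accepted :: "decision list \<Rightarrow> nat" where
  "num_accepted S = length (filter (\<lambda>d. d \<noteq> None) S)"

text \<open>A deterministic online algorithm is a function giving the decision for the last request of a
  nonempty sequence from that sequence alone. Its earlier decisions need not be passed to it, as they
  are determined by the earlier requests.\<close>

type_synonym online = "request list \<Rightarrow> decision"

definition run :: "online \<Rightarrow> request list \<Rightarrow> decision list" where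
  "run A I = map (\<lambda>i. A (take (Suc i) I)) [0..<length I]"

definition online_algorithm :: "nat \<Rightarrow> nat \<Rightarrow> online \<Rightarrow> bool" where
  "online_algorithm n k A \<longleftrightarrow> (\<forall>I \<in> inputs k. valid_solution n I (run A I))"

definition fits :: "request list \<Rightarrow> decision list \<Rightarrow> nat \<Rightarrow> request \<Rightarrow> bool" where
  "fits I S p r \<longleftrightarrow> (\<forall>i < length I. S ! i = Some p \<longrightarrow> \<not> overlap (I ! i) r)"

definition fair :: "nat \<Rightarrow> nat \<Rightarrow> online \<Rightarrow> bool" where
  "fair n k A \<longleftrightarrow>
     (\<forall>I \<in> inputs k. \<forall>r \<in> requests k. (\<exists>p < n. fits I (run A I) p r) \<longrightarrow> A (I @ [r]) \<noteq> None)"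

definition online_bounded_solutions :: "nat \<Rightarrow> online \<Rightarrow> request list \<Rightarrow> decision list set" where
  "online_bounded_solutions n A I =
     {S. valid_solution n I S \<and>
         (\<forall>m \<le> length I. num_accepted (run A (take m I)) \<le> num_accepted (take m S))}"

text \<open>An offline algorithm picks its solution for each input separately, so the value of an optimal one
  is the maximum over all admissible solutions of the given input.\<close>

definition Opt :: "nat \<Rightarrow> online \<Rightarrow> request list \<Rightarrow> nat" where
  "Opt n A I = Max (num_accepted ` online_bounded_solutions n A I)"

definition online_bounded_ratio :: "nat \<Rightarrow> nat \<Rightarrow> online \<Rightarrow> ereal" where
  "online_bounded_ratio n k A =
     Sup {ereal c | c :: real.
            \<forall>I \<in> inputs k. real (num_accepted (run A I)) \<ge> c * real (Opt n A I)}"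

text \<open>The maximum in \<open>Opt\<close> is over a finite nonempty set.\<close>

lemma finite_accepted: "finite (num_accepted ` online_bounded_solutions n A I)"
proof (rule finite_subset)
  show "num_accepted ` online_bounded_solutions n A I \<subseteq> {..length I}"
    by (auto simp: online_bounded_solutions_def valid_solution_def num_accepted_def
        intro: order_trans[OF length_filter_le])
qed simp

lemma take_run: "take m (run A I) = run A (take m I)"
  by (rule nth_equalityI) (auto simp: run_def take_map min.absorb1 Suc_le_eq)

lemma run_online_bounded:
  assumes "online_algorithm n k A" "I \<in> inputs k"
  shows "run A I \<in> online_bounded_solutions n A I"
  using assms by (auto simp: online_bounded_solutions_def online_algorithm_def take_run)

end

theory Submission
  imports Defs
begin

text \<open>Let \<open>m = n div 2\<close> and \<open>l = n - m\<close>. The adversary first gives \<open>m\<close> requests \<open>[1, 2)\<close> and \<open>l\<close> requests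
  \<open>[3, 4)\<close>; let \<open>q\<close> be the number of seats on which the algorithm combines the two kinds. If \<open>q\<close> is
  small, then \<open>m\<close> requests \<open>[1, 4)\<close> follow: the offline algorithm, having combined as much as possible,
  accepts all of them, the online algorithm at most \<open>q\<close>. If \<open>q\<close> is large, then \<open>l\<close> requests \<open>[1, 3)\<close> and
  \<open>m\<close> requests \<open>[2, 4)\<close> follow: the offline algorithm, having combined nothing, accepts all of them,
  the online algorithm loses \<open>q\<close> of the latter. In either case the offline algorithm leads by some
  \<open>d\<close>, uses this lead to reject \<open>d\<close> of \<open>n\<close> requests \<open>[4, k)\<close> that fill all seats of the online
  algorithm, and then gains \<open>d * (k - 4)\<close> unit intervals on the seats it kept free. The online
  algorithm ends with at most \<open>11 * d\<close> accepted requests; the worst case is \<open>n = 5\<close>, \<open>q = 1\<close>.\<close>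

section \<open>Runs, occupied seats and fitting requests\<close>

lemma run_snoc: "run A (I @ [r]) = run A I @ [A (I @ [r])]"
  by (rule nth_equalityI) (auto simp: run_def nth_append less_Suc_eq)

lemma length_run [simp]: "length (run A I) = length I"
  by (simp add: run_def)

lemma run_Nil [simp]: "run A [] = []"
  by (simp add: run_def)

lemma num_accepted_simps [simp]:
  "num_accepted [] = 0"
  "num_accepted (S @ T) = num_accepted S + num_accepted T"
  "num_accepted [Some p] = 1"
  "num_accepted [None] = 0"
  "num_accepted (map Some xs) = length xs"
  "num_accepted (replicate c None) = 0"
  by (auto simp: num_accepted_def filter_map comp_def)

lemma num_accepted_le_length: "num_accepted S \<le> length S"
  by (simp add: num_accepted_def)

text \<open>For a block of copies of one request, a later request only depends on which seats the
  block occupies, so a set suffices (see \<open>fits_replicate\<close>).\<close>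

definition seats :: "decision list \<Rightarrow> nat set" where
  "seats S = {p. Some p \<in> set S}"

lemma seats_simps [simp]:
  "seats [] = {}"
  "seats (S @ T) = seats S \<union> seats T"
  "seats [Some p] = {p}"
  "seats [None] = {}"
  "seats (map Some xs) = set xs"
  "seats (replicate c None) = {}"
  by (auto simp: seats_def)

lemma overlap_iff: "overlap r s \<longleftrightarrow> max (fst r) (fst s) < min (snd r) (snd s)"
proof -
  have "{fst r..<snd r} \<inter> {fst s..<snd s} = {max (fst r) (fst s)..<min (snd r) (snd s)}"
    by auto
  then show ?thesis
    unfolding overlap_def by (simp only: atLeastLessThan_empty_iff not_not)
qed

lemma overlap_commute: "overlap r s \<longleftrightarrow> overlap s r"
  by (auto simp: overlap_def)

lemma fits_Nil [simp]: "fits [] S p s"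
  by (simp add: fits_def)

lemma fits_snoc:
  assumes "length S = length I"
  shows "fits (I @ [r]) (S @ [d]) p s \<longleftrightarrow> fits I S p s \<and> (d = Some p \<longrightarrow> \<not> overlap r s)"
  using assms by (auto simp: fits_def nth_append less_Suc_eq)

lemma fits_append:
  assumes "length S = length I" "length T = length J"
  shows "fits (I @ J) (S @ T) p s \<longleftrightarrow> fits I S p s \<and> fits J T p s"
  using assms(2,1)
proof (induction T J rule: rev_induct2)
  case (4 x xs y ys)
  then show ?case
    using fits_snoc[of "S @ xs" "I @ ys"] fits_snoc[of xs ys] by simp
qed simp_all

lemma fits_replicate:
  assumes "length T = c"
  shows "fits (replicate c r) T p s \<longleftrightarrow> (p \<in> seats T \<longrightarrow> \<not> overlap r s)"
  using assms by (auto simp: fits_def seats_def in_set_conv_nth)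

section \<open>Extending valid solutions\<close>

lemma valid_solution_snoc:
  "valid_solution n (I @ [r]) (S @ [d]) \<longleftrightarrow>
     valid_solution n I S \<and> (\<forall>p. d = Some p \<longrightarrow> p < n \<and> fits I S p r)"
proof (cases "length S = length I")
  case True
  have seat: "(\<forall>i < length (I @ [r]). \<forall>p. (S @ [d]) ! i = Some p \<longrightarrow> p < n) \<longleftrightarrow>
      (\<forall>i < length I. \<forall>p. S ! i = Some p \<longrightarrow> p < n) \<and> (\<forall>p. d = Some p \<longrightarrow> p < n)"
    using True by (simp add: All_less_Suc nth_append conj_commute)
  have disj: "(\<forall>i < length (I @ [r]). \<forall>j < length (I @ [r]). \<forall>p.
        i \<noteq> j \<and> (S @ [d]) ! i = Some p \<and> (S @ [d]) ! j = Some p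
          \<longrightarrow> \<not> overlap ((I @ [r]) ! i) ((I @ [r]) ! j)) \<longleftrightarrow>
      (\<forall>i < length I. \<forall>j < length I. \<forall>p.
        i \<noteq> j \<and> S ! i = Some p \<and> S ! j = Some p \<longrightarrow> \<not> overlap (I ! i) (I ! j)) \<and>
      (\<forall>p. d = Some p \<longrightarrow> fits I S p r)" (is "?L \<longleftrightarrow> ?R1 \<and> ?R2")
  proof (intro iffI conjI)
    assume L: ?L
    show ?R1
    proof (intro allI impI)
      fix i j p
      assume "i < length I" "j < length I" "i \<noteq> j \<and> S ! i = Some p \<and> S ! j = Some p"
      then show "\<not> overlap (I ! i) (I ! j)"
        using L[rule_format, of i j p] True by (simp add: nth_append)
    qed
    show ?R2
      unfolding fits_def
    proof (intro allI impI)
      fix i p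
      assume "i < length I" "d = Some p" "S ! i = Some p"
      then show "\<not> overlap (I ! i) r"
        using L[rule_format, of i "length I" p] True by (simp add: nth_append)
    qed
  next
    assume R: "?R1 \<and> ?R2"
    then have R1: "\<not> overlap (I ! i) (I ! j)"
      if "i < length I" "j < length I" "i \<noteq> j" "S ! i = Some p" "S ! j = Some p" for i j p
      using that by blast
    from R have R2: "\<not> overlap (I ! i) r" if "i < length I" "S ! i = Some p" "d = Some p" for i p
      using that by (simp add: fits_def)
    show ?L
    proof (intro allI impI)
      fix i j p
      assume "i < length (I @ [r])" "j < length (I @ [r])"
        and *: "i \<noteq> j \<and> (S @ [d]) ! i = Some p \<and> (S @ [d]) ! j = Some p"
      \<comment> \<open>The pair of two last indices is excluded by \<open>i \<noteq> j\<close>; the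
        two mixed cases differ by the symmetry of \<open>overlap\<close>.\<close>
      then consider "i < length I" "j < length I" | "i < length I" "j = length I"
        | "i = length I" "j < length I"
        by (auto simp: less_Suc_eq)
      then show "\<not> overlap ((I @ [r]) ! i) ((I @ [r]) ! j)"
      proof cases
        case 1
        then show ?thesis
          using * True R1[of i j p] by (simp add: nth_append)
      next
        case 2
        then show ?thesis
          using * True R2[of i p] by (simp add: nth_append)
      next
        case 3
        then show ?thesis
          using * True R2[of j p] by (simp add: nth_append overlap_commute[of r])
      qed
    qed
  qed
  show ?thesis
    unfolding valid_solution_def seat disj using True by auto
qed (simp add: valid_solution_def)

lemma valid_solution_Nil [simp]: "valid_solution n [] []"
  by (simp add: valid_solution_def)

text \<open>Distinct seats rule out conflicts inside the block, so the fit has to be checked only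
  against what precedes it.\<close>

lemma valid_solution_replicate_Some:
  assumes "valid_solution n I S" "distinct xs" "\<And>p. p \<in> set xs \<Longrightarrow> p < n \<and> fits I S p r"
  shows "valid_solution n (I @ replicate (length xs) r) (S @ map Some xs)"
  using assms
proof (induction xs rule: rev_induct)
  case (snoc x xs)
  have len: "length S = length I"
    using snoc.prems by (simp add: valid_solution_def)
  have "valid_solution n ((I @ replicate (length xs) r) @ [r]) ((S @ map Some xs) @ [Some x])"
    unfolding valid_solution_snoc using snoc len by (auto simp: fits_append fits_replicate)
  then show ?case
    by (simp add: replicate_append_same)
qed simp

lemma valid_solution_replicate_None:
  assumes "valid_solution n I S"
  shows "valid_solution n (I @ replicate c r) (S @ replicate c None)"
proof (induction c)
  case (Suc c)
  then have "valid_solution n ((I @ replicate c r) @ [r]) ((S @ replicate c None) @ [None])"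
    unfolding valid_solution_snoc by simp
  then show ?case
    by (simp add: replicate_append_same)
qed (simp add: assms)

section \<open>Blocks of equal requests under a fair algorithm\<close>

lemma inputs_simps [simp]:
  "[] \<in> inputs k"
  "I @ J \<in> inputs k \<longleftrightarrow> I \<in> inputs k \<and> J \<in> inputs k"
  by (auto simp: inputs_def)

lemma replicate_in_inputs [intro]: "r \<in> requests k \<Longrightarrow> replicate c r \<in> inputs k"
  by (auto simp: inputs_def)

text \<open>Validity sends the accepted copies to different seats among those free before the block;
  fairness accepts as long as such a seat remains. The inclusion bounds the number of acceptances
  from above, and the last clause makes it exact when there is room.\<close>

lemma run_replicate:
  assumes "online_algorithm n k A" "fair n k A" "I \<in> inputs k" "r \<in> requests k"
  obtains D where "run A (I @ replicate c r) = run A I @ D" "length D = c"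
    "num_accepted D = card (seats D)" "finite (seats D)"
    "seats D \<subseteq> {p. p < n \<and> fits I (run A I) p r}"
    "c \<le> card {p. p < n \<and> fits I (run A I) p r} \<Longrightarrow> card (seats D) = c"
proof -
  let ?F = "{p. p < n \<and> fits I (run A I) p r}"
  have self: "overlap r r"
    using assms(4) by (auto simp: requests_def overlap_iff)
  have "\<exists>D. run A (I @ replicate c r) = run A I @ D \<and> length D = c \<and>
    num_accepted D = card (seats D) \<and> finite (seats D) \<and> seats D \<subseteq> ?F \<and>
    (c \<le> card ?F \<longrightarrow> card (seats D) = c)"
  proof (induction c)
    case 0
    then show ?case by (intro exI[of _ "[]"]) simp
  next
    case (Suc c)
    then obtain D where D: "run A (I @ replicate c r) = run A I @ D" "length D = c"
      "num_accepted D = card (seats D)" "finite (seats D)" "seats D \<subseteq> ?F"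
      "c \<le> card ?F \<longrightarrow> card (seats D) = c"
      by (elim exE conjE)
    let ?J = "I @ replicate c r"
    let ?d = "A (?J @ [r])"
    have J: "?J \<in> inputs k" "?J @ [r] \<in> inputs k"
      using assms(3,4) by (auto simp: inputs_def)
    have run: "run A (?J @ [r]) = (run A I @ D) @ [?d]"
      using run_snoc[of A ?J r] D(1) by simp
    \<comment> \<open>As \<open>r\<close> overlaps itself, each copy blocks its seat for the next
      ones.\<close>
    have fits: "fits ?J (run A ?J) p r \<longleftrightarrow> fits I (run A I) p r \<and> p \<notin> seats D" for p
      using D(1,2) self by (simp add: fits_append fits_replicate)
    have "valid_solution n (?J @ [r]) (run A (?J @ [r]))"
      using assms(1) J(2) unfolding online_algorithm_def by blast
    then have some: "p \<in> ?F - seats D" if "?d = Some p" for p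
      unfolding run_snoc valid_solution_snoc using that fits by blast
    have fair: "?d \<noteq> None" if "p \<in> ?F - seats D" for p
      using assms(2,4) J(1) that fits unfolding fair_def by blast
    have ex: "\<exists>p. p \<in> ?F - seats D" if "Suc c \<le> card ?F"
    proof -
      have "card (seats D) < card ?F"
        using that D(6) by simp
      then have "\<not> ?F \<subseteq> seats D"
        using card_mono[OF D(4), of ?F] by linarith
      then show ?thesis
        by blast
    qed
    show ?case
    proof (intro exI[of _ "D @ [?d]"] conjI impI)
      show "run A (I @ replicate (Suc c) r) = run A I @ D @ [?d]"
        using run by (simp add: replicate_append_same)
      show "card (seats (D @ [?d])) = Suc c" if c: "Suc c \<le> card ?F"
      proof -
        obtain p where "?d = Some p"
          using ex[OF c] fair by blast
        then show ?thesis
          using some[of p] D(4,6) c by simp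
      qed
      show "num_accepted (D @ [?d]) = card (seats (D @ [?d]))"
        using some D(3,4) by (cases ?d) auto
      show "seats (D @ [?d]) \<subseteq> ?F"
        using some D(5) by (cases ?d) auto
      show "finite (seats (D @ [?d]))"
        using D(4) by (cases ?d) auto
    qed (simp add: D(2))
  qed
  then show ?thesis
    by (elim exE conjE) (rule that, simp_all)
qed

section \<open>The offline optimum and the closing unit requests\<close>

lemma Opt_ge:
  assumes "S \<in> online_bounded_solutions n A I"
  shows "num_accepted S \<le> Opt n A I"
  using assms unfolding Opt_def by (intro Max_ge finite_accepted) auto

text \<open>The closing requests, from which only seats kept free can profit. Listing them station
  by station makes a step in \<open>k\<close> append one block.\<close>

definition units :: "nat \<Rightarrow> nat \<Rightarrow> request list" where
  "units d k = concat (map (\<lambda>j. replicate d (j, Suc j)) [4..<k])"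

lemma units_Suc: "4 \<le> k \<Longrightarrow> units d (Suc k) = units d k @ replicate d (k, Suc k)"
  by (simp add: units_def)

lemma units_4 [simp]: "units d 4 = []"
  by (simp add: units_def)

lemma units_in_inputs: "units d k \<in> inputs k"
  by (auto simp: units_def inputs_def requests_def)

text \<open>Distinct unit intervals are disjoint, so each seat of \<open>xs\<close> takes one copy
  of every one of them.\<close>

lemma valid_solution_units:
  assumes "valid_solution n I S" "4 \<le> k" "distinct xs" "set xs \<subseteq> {..<n}"
    and "\<And>p j. p \<in> set xs \<Longrightarrow> 4 \<le> j \<Longrightarrow> fits I S p (j, Suc j)"
  shows "\<exists>ys. valid_solution n (I @ units (length xs) k) (S @ map Some ys) \<and>
    length ys = length xs * (k - 4)"
proof -
  have len: "length S = length I"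
    using assms(1) by (simp add: valid_solution_def)
  \<comment> \<open>Strengthened for the induction: the seats of \<open>xs\<close> stay free from
    station \<open>k\<close> on.\<close>
  have "\<exists>ys. valid_solution n (I @ units (length xs) k) (S @ map Some ys) \<and>
      length ys = length xs * (k - 4) \<and>
      (\<forall>p\<in>set xs. \<forall>j\<ge>k. fits (I @ units (length xs) k) (S @ map Some ys) p (j, Suc j))"
    using assms(2)
  proof (induction k rule: dec_induct)
    case base
    then show ?case
      using assms by (intro exI[of _ "[]"]) simp
  next
    case (step k)
    then obtain ys where ys: "valid_solution n (I @ units (length xs) k) (S @ map Some ys)"
      "length ys = length xs * (k - 4)"
      "\<forall>p\<in>set xs. \<forall>j\<ge>k. fits (I @ units (length xs) k) (S @ map Some ys) p (j, Suc j)"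
      by blast
    let ?I = "I @ units (length xs) k" and ?S = "S @ map Some ys"
    have len': "length ?S = length ?I"
      using ys(1) by (simp add: valid_solution_def)
    have "valid_solution n (?I @ replicate (length xs) (k, Suc k)) (?S @ map Some xs)"
      using ys assms(3,4) by (intro valid_solution_replicate_Some) auto
    moreover have "\<forall>p\<in>set xs. \<forall>j\<ge>Suc k.
        fits (?I @ replicate (length xs) (k, Suc k)) (?S @ map Some xs) p (j, Suc j)"
      using ys(3) len' by (subst fits_append) (auto simp: fits_replicate overlap_iff)
    moreover have "length (ys @ xs) = length xs * (Suc k - 4)"
      unfolding Suc_diff_le[OF step(1)] using ys(2) by simp
    ultimately show ?case
      using step(1) by (intro exI[of _ "ys @ xs"]) (simp add: units_Suc)
  qed
  then show ?thesis
    by blast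
qed

text \<open>By validity, a request that fits on no seat is rejected. Rejections change no seat, so
  testing the fit after \<open>I\<close> is enough.\<close>

lemma run_full:
  assumes alg: "online_algorithm n k A" and I: "I @ J \<in> inputs k"
    and full: "\<And>p r. p < n \<Longrightarrow> r \<in> set J \<Longrightarrow> \<not> fits I (run A I) p r"
  shows "run A (I @ J) = run A I @ replicate (length J) None"
  using I full
proof (induction J rule: rev_induct)
  case (snoc r J)
  then have IH: "run A (I @ J) = run A I @ replicate (length J) None"
    by simp
  have "valid_solution n ((I @ J) @ [r]) (run A ((I @ J) @ [r]))"
    using alg snoc.prems(1) unfolding online_algorithm_def by simp
  then have "A ((I @ J) @ [r]) = Some p \<Longrightarrow> p < n \<and> fits (I @ J) (run A (I @ J)) p r" for p
    unfolding run_snoc valid_solution_snoc by blast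
  moreover have "\<not> fits (I @ J) (run A (I @ J)) p r" if "p < n" for p
    unfolding IH using snoc.prems(2)[OF that] by (simp add: fits_append)
  ultimately have "A ((I @ J) @ [r]) = None"
    by (cases "A ((I @ J) @ [r])") auto
  then show ?case
    using run_snoc[of A "I @ J" r] IH by (simp add: replicate_append_same)
qed simp

section \<open>Turning a lead into a ratio\<close>

text \<open>The left side is online, the right side offline. While offline accepts everything it
  cannot be behind; when that ends, after \<open>zs\<close>, it has already accepted as many as
  online ever will.\<close>

lemma prefix_domination:
  assumes "length R = length xs" "num_accepted R + d \<le> length xs"
    and "length D = length zs + d"
  shows "num_accepted (take t (R @ D @ replicate l None))
    \<le> num_accepted (take t (map Some xs @ map Some zs @ replicate d None @ map Some ys))"
proof (cases "t \<le> length xs + length zs")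
  case True
  have "num_accepted (take t (R @ D @ replicate l None)) \<le> t"
    by (rule order_trans[OF num_accepted_le_length]) simp
  then show ?thesis
    using True by (simp add: take_map)
next
  case False
  have "num_accepted (take t (R @ D @ replicate l None)) \<le> num_accepted R + length D"
    using False assms(1) num_accepted_le_length[of "take (t - length xs) D"]
    by simp
  also have "\<dots> \<le> length xs + length zs"
    using assms by simp
  finally show ?thesis
    using False by simp
qed

text \<open>With \<open>a = num_accepted (run A I) + n\<close> the final online count, offline
  reaches at least \<open>a + d * (k - 4)\<close>. Since \<open>a \<le> 11 * d\<close>, this is at
  least \<open>a * (1 + (k - 4) / 11) = a * (k + 7) / 11\<close>.\<close>

lemma ratio_violated_of_lead:
  assumes alg: "online_algorithm n k A" and fair: "fair n k A" and k: "k \<ge> 5"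
    and I: "I \<in> inputs k" and short: "\<And>r. r \<in> set I \<Longrightarrow> snd r \<le> 4"
    and xs: "valid_solution n I (map Some xs)"
    and d: "d \<le> n" "num_accepted (run A I) + d \<le> length I"
    and lead: "num_accepted (run A I) + n \<le> 11 * d"
    and c: "c > 11 / (real k + 7)" and n: "n > 0"
  shows "\<exists>J \<in> inputs k. real (num_accepted (run A J)) < c * real (Opt n A J)"
proof -
  let ?L = "I @ replicate n (4, k)"
  let ?J = "?L @ units d k"
  have len: "length xs = length I"
    using xs by (simp add: valid_solution_def)
  have 4: "(4, k) \<in> requests k"
    using k by (simp add: requests_def)
  have J: "?L \<in> inputs k" "?J \<in> inputs k"
    using I 4 units_in_inputs by auto
  have free: "fits I S p s" if "4 \<le> fst s" for S p s
  proof -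
    have "\<not> overlap (I ! i) s" if "i < length I" for i
      using short[OF nth_mem[OF that]] \<open>4 \<le> fst s\<close> by (simp add: overlap_iff)
    then show ?thesis
      by (simp add: fits_def)
  qed
  obtain D where D: "run A ?L = run A I @ D" "length D = n"
    "num_accepted D = card (seats D)" "finite (seats D)" "seats D \<subseteq> {p. p < n \<and> fits I (run A I) p (4, k)}"
    "n \<le> card {p. p < n \<and> fits I (run A I) p (4, k)} \<Longrightarrow> card (seats D) = n"
    by (rule run_replicate[OF alg fair I 4, of n]) (rule that)
  \<comment> \<open>All of \<open>I\<close> ends by station 4, so every seat is free there and
    fairness puts one long request on each.\<close>
  have F: "{p. p < n \<and> fits I (run A I) p (4, k)} = {..<n}"
    using free by auto
  have cD: "card (seats D) = n"
    using D(6) unfolding F by simp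
  have "seats D = {..<n}"
    using D(5) cD unfolding F by (simp add: card_subset_eq)
  moreover have "overlap (4, k) r" if "r \<in> set (units d k)" for r
    using that by (auto simp: units_def overlap_iff)
  ultimately have nofit: "\<not> fits ?L (run A ?L) p r" if "p < n" "r \<in> set (units d k)" for p r
    using that D(1,2) by (simp add: fits_append fits_replicate)
  have runJ: "run A ?J = run A I @ D @ replicate (length (units d k)) None"
    using run_full[OF alg J(2) nofit] D(1) by simp
  have numA: "num_accepted (run A ?J) = num_accepted (run A I) + n"
    using runJ D(3) cD by simp

  \<comment> \<open>Offline rejects the last \<open>d\<close> long requests, which keeps the seats
    \<open>[n - d..<n]\<close> free from station 4 on.\<close>
  have "valid_solution n (I @ replicate (n - d) (4, k)) (map Some xs @ map Some [0..<n - d])"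
    using valid_solution_replicate_Some[OF xs, of "[0..<n-d]" "(4, k)"] free by simp
  then have "valid_solution n ((I @ replicate (n - d) (4, k)) @ replicate d (4, k))
      ((map Some xs @ map Some [0..<n - d]) @ replicate d None)"
    by (rule valid_solution_replicate_None)
  moreover have "(I @ replicate (n - d) (4, k)) @ replicate d (4, k) = ?L"
    using d(1) by (simp add: replicate_add[symmetric])
  ultimately have vL: "valid_solution n ?L (map Some xs @ map Some [0..<n - d] @ replicate d None)"
    by simp
  have fit: "fits ?L (map Some xs @ map Some [0..<n - d] @ replicate d None) p (j, Suc j)"
    if "p \<in> set [n - d..<n]" "4 \<le> j" for p j
    using that free[of "(j, Suc j)"] len d(1) by (subst fits_append) (auto simp: fits_replicate)
  have "\<exists>ys. valid_solution n (?L @ units (length [n - d..<n]) k)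
        ((map Some xs @ map Some [0..<n - d] @ replicate d None) @ map Some ys) \<and>
      length ys = length [n - d..<n] * (k - 4)"
    by (rule valid_solution_units[OF vL]) (use k fit in \<open>simp_all add: subset_eq\<close>)
  then obtain ys where ys: "valid_solution n (?L @ units d k)
        ((map Some xs @ map Some [0..<n - d] @ replicate d None) @ map Some ys)"
      "length ys = d * (k - 4)"
    using d(1) by auto
  let ?S = "map Some xs @ map Some [0..<n - d] @ replicate d None @ map Some ys"
  have dom: "num_accepted (take t (run A ?J)) \<le> num_accepted (take t ?S)" for t
    unfolding runJ by (rule prefix_domination) (use d len D(2) in simp_all)
  have "?S \<in> online_bounded_solutions n A ?J"
    unfolding online_bounded_solutions_def mem_Collect_eq take_run[symmetric]
    using ys(1) dom by simp
  then have "length xs + (n - d) + d * (k - 4) \<le> Opt n A ?J"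
    using Opt_ge[of ?S n A ?J] ys(2) d(1) by simp
  \<comment> \<open>The lead \<open>d\<close> on \<open>I\<close> offsets the \<open>d\<close>
    rejected long requests.\<close>
  then have "num_accepted (run A ?J) + d * (k - 4) \<le> Opt n A ?J"
    using d len numA by simp
  then have "real (num_accepted (run A ?J) + d * (k - 4)) \<le> real (Opt n A ?J)"
    by (simp only: of_nat_le_iff)
  then have opt: "real (num_accepted (run A ?J)) + real d * (real k - 4) \<le> real (Opt n A ?J)"
    using k by (simp add: of_nat_diff)
  let ?a = "real (num_accepted (run A ?J))"
  have "?a * (real k - 4) \<le> 11 * real d * (real k - 4)"
    using lead numA k by (intro mult_right_mono) auto
  then have "?a * (real k + 7) \<le> 11 * real (Opt n A ?J)"
    using opt by (simp add: algebra_simps)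
  then have "?a \<le> 11 / (real k + 7) * real (Opt n A ?J)"
    by (simp add: field_simps)
  also have "\<dots> < c * real (Opt n A ?J)"
  proof (rule mult_strict_right_mono[OF c])
    have "0 \<le> real d * (real k - 4)"
      using k by simp
    then show "0 < real (Opt n A ?J)"
      using opt numA n by simp
  qed
  finally show ?thesis
    using J(2) by blast
qed

text \<open>Serves \<open>k \<le> 4\<close>, where the claimed bound is at least 1. One request
  suffices: fairness accepts it, and the run itself is an admissible offline solution.\<close>

lemma ratio_above_one_violated:
  assumes alg: "online_algorithm n k A" and fair: "fair n k A"
    and "n > 0" "k \<ge> 2" and c: "c > (1::real)"
  shows "\<exists>J \<in> inputs k. real (num_accepted (run A J)) < c * real (Opt n A J)"
proof -
  have r: "(1, 2) \<in> requests k"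
    using assms by (simp add: requests_def)
  obtain D where "run A ([] @ replicate 1 (1, 2)) = run A [] @ D" "num_accepted D = card (seats D)"
    "1 \<le> card {p. p < n \<and> fits [] (run A []) p (1, 2)} \<Longrightarrow> card (seats D) = 1"
    by (rule run_replicate[OF alg fair _ r, of "[]" 1]) auto
  then have one: "num_accepted (run A [(1, 2)]) = 1"
    using assms(3) by simp
  have I: "[(1, 2)] \<in> inputs k"
    using r by (simp add: inputs_def)
  have "1 \<le> Opt n A [(1, 2)]"
    using Opt_ge[OF run_online_bounded[OF alg I]] one by simp
  then have "1 * 1 < c * real (Opt n A [(1, 2)])"
    using c by (intro mult_less_le_imp_less) auto
  then show ?thesis
    using one I by (intro bexI[of _ "[(1, 2)]"]) simp_all
qed

section \<open>The adversary's opening and its two continuations\<close>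

lemma ratio_violated:
  assumes alg: "online_algorithm n k A" and fair: "fair n k A"
    and n: "n \<ge> 2" and k: "k \<ge> 5" and c: "c > 11 / (real k + 7)"
  shows "\<exists>J \<in> inputs k. real (num_accepted (run A J)) < c * real (Opt n A J)"
proof -
  \<comment> \<open>Rounding down gives \<open>m \<le> l\<close>, so offline can combine every
    \<open>(1, 2)\<close> with a \<open>(3, 4)\<close>.\<close>
  define m where "m = n div 2"
  define l where "l = n - m"
  have ml: "m + l = n" "m \<le> l"
    by (auto simp: m_def l_def)
  have req: "(1, 2) \<in> requests k" "(3, 4) \<in> requests k" "(1, 4) \<in> requests k"
    "(1, 3) \<in> requests k" "(2, 4) \<in> requests k"
    using k by (auto simp: requests_def)
  note run_blk = run_replicate[OF alg fair]
  let ?I1 = "replicate m (1::nat, 2::nat)"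
  let ?I2 = "?I1 @ replicate l (3, 4)"
  have in1: "?I1 \<in> inputs k" and in2: "?I2 \<in> inputs k"
    using req by auto
  obtain D1 where D1: "run A ?I1 = D1" "length D1 = m" "num_accepted D1 = card (seats D1)"
    "finite (seats D1)" "seats D1 \<subseteq> {..<n}" "card (seats D1) = m"
    by (rule run_blk[of "[]" "(1, 2)" m]) (use req ml in auto)
  have F2: "{p. p < n \<and> fits ?I1 (run A ?I1) p (3, 4)} = {..<n}"
    using D1(1,2) by (auto simp: fits_replicate overlap_iff)
  obtain D2 where D2: "run A ?I2 = D1 @ D2" "length D2 = l"
    "num_accepted D2 = card (seats D2)" "finite (seats D2)" "seats D2 \<subseteq> {..<n}" "card (seats D2) = l"
    by (rule run_blk[OF in1 req(2), of l]) (use F2 D1(1) ml in auto)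
  define q where "q = card (seats D1 \<inter> seats D2)"
  \<comment> \<open>Exactly \<open>n - q\<close> seats are in use, hence \<open>q\<close> are
    empty.\<close>
  have un: "card (seats D1 \<union> seats D2) + q = n"
    using card_Un_Int[OF D1(4) D2(4)] D1(6) D2(6) ml by (simp add: q_def)
  have q: "q \<le> m"
    using card_mono[of "seats D1" "seats D1 \<inter> seats D2"] D1(4,6) by (simp add: q_def)
  have num2: "num_accepted (run A ?I2) = n"
    using D1(3,6) D2(1,3,6) ml by simp
  have "n = 2 * m \<or> n = 2 * m + 1"
    unfolding m_def by presburger
  \<comment> \<open>These are the lead conditions of the two continuations:
    \<open>(n + q) + n \<le> 11 * (m - q)\<close> with lead \<open>m - q\<close>, and
    \<open>(2 * n - q) + n \<le> 11 * q\<close> with lead \<open>q\<close>. For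
    \<open>n = 5\<close>, \<open>q = 1\<close> only the first holds, with equality, which determines
    the constant 11.\<close>
  then have "2 * n + 12 * q \<le> 11 * m \<or> 3 * n \<le> 12 * q"
    using n by presburger
  then consider "2 * n + 12 * q \<le> 11 * m" | "3 * n \<le> 12 * q"
    by blast
  then show ?thesis
  proof cases
    case 1
    let ?I3 = "?I2 @ replicate m (1, 4)"
    obtain D3 where D3: "run A ?I3 = run A ?I2 @ D3" "num_accepted D3 = card (seats D3)"
      "seats D3 \<subseteq> {p. p < n \<and> fits ?I2 (run A ?I2) p (1, 4)}"
      by (rule run_blk[OF in2 req(3), of m]) auto
    \<comment> \<open>\<open>(1, 4)\<close> overlaps both kinds, so only empty seats remain for
      it.\<close>
    have "{p. p < n \<and> fits ?I2 (run A ?I2) p (1, 4)} = {..<n} - (seats D1 \<union> seats D2)"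
      using D1(2) D2(1,2) by (auto simp: fits_append fits_replicate overlap_iff)
    moreover have "card ({..<n} - (seats D1 \<union> seats D2)) = q"
      using un D1(4,5) D2(4,5) by (subst card_Diff_subset) auto
    ultimately have "card (seats D3) \<le> q"
      using D3(3) by (metis card_mono finite_Diff finite_lessThan)
    then have num3: "num_accepted (run A ?I3) \<le> n + q"
      using D3(1,2) num2 by simp
    \<comment> \<open>Offline uses only the seats below \<open>l\<close> for the opening; the other
      \<open>m\<close> take the requests \<open>(1, 4)\<close>.\<close>
    have "valid_solution n ?I1 (map Some [0..<m])"
      using valid_solution_replicate_Some[of n "[]" "[]" "[0..<m]"] ml by simp
    then have "valid_solution n ?I2 (map Some [0..<m] @ map Some [0..<l])"
      using valid_solution_replicate_Some[of n ?I1 "map Some [0..<m]" "[0..<l]" "(3, 4)"] ml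
      by (simp add: fits_replicate overlap_iff)
    then have "valid_solution n ?I3 ((map Some [0..<m] @ map Some [0..<l]) @ map Some [l..<n])"
      using valid_solution_replicate_Some[of n ?I2 "map Some [0..<m] @ map Some [0..<l]"
          "[l..<n]" "(1, 4)"] ml
      by (auto simp: fits_append fits_replicate overlap_iff l_def)
    then have S: "valid_solution n ?I3 (map Some ([0..<m] @ [0..<l] @ [l..<n]))"
      by simp
    show ?thesis
    proof (rule ratio_violated_of_lead[OF alg fair k _ _ S])
      show "?I3 \<in> inputs k"
        using in2 req by auto
      show "num_accepted (run A ?I3) + (m - q) \<le> length ?I3"
        using num3 ml q by simp
      show "num_accepted (run A ?I3) + n \<le> 11 * (m - q)"
        using num3 1 by linarith
    qed (use c n ml in auto)
  next
    case 2
    let ?I3 = "?I2 @ replicate l (1, 3)"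
    let ?I4 = "?I3 @ replicate m (2, 4)"
    have in3: "?I3 \<in> inputs k"
      using in2 req by auto
    \<comment> \<open>\<open>(1, 3)\<close> conflicts only with \<open>(1, 2)\<close>, so exactly
      \<open>l\<close> seats are free for it and the block fills them all.\<close>
    have F3: "{p. p < n \<and> fits ?I2 (run A ?I2) p (1, 3)} = {..<n} - seats D1"
      using D1(2) D2(1,2) by (auto simp: fits_append fits_replicate overlap_iff)
    have cF3: "card ({..<n} - seats D1) = l"
      using D1 ml by (subst card_Diff_subset) auto
    obtain D3 where D3: "run A ?I3 = run A ?I2 @ D3" "length D3 = l"
      "num_accepted D3 = card (seats D3)"
      "seats D3 \<subseteq> {..<n} - seats D1" "card (seats D3) = l"
      by (rule run_blk[OF in2 req(4), of l]) (use F3 cF3 in auto)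
    have s3: "seats D3 = {..<n} - seats D1"
      using D3(4,5) cF3 by (intro card_subset_eq) auto
    obtain D4 where D4: "run A ?I4 = run A ?I3 @ D4" "num_accepted D4 = card (seats D4)"
      "seats D4 \<subseteq> {p. p < n \<and> fits ?I3 (run A ?I3) p (2, 4)}"
      by (rule run_blk[OF in3 req(5), of m]) auto
    \<comment> \<open>\<open>(2, 4)\<close> conflicts with \<open>(3, 4)\<close> and
      \<open>(1, 3)\<close>; what remains are the seats holding \<open>(1, 2)\<close> alone.\<close>
    have "{p. p < n \<and> fits ?I3 (run A ?I3) p (2, 4)} = seats D1 - (seats D1 \<inter> seats D2)"
      using D1(2,5) D2(1,2) D3(1,2) s3
      by (auto simp: fits_append fits_replicate overlap_iff)
    moreover have "card (seats D1 - (seats D1 \<inter> seats D2)) = m - q"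
      using D1(4,6) by (subst card_Diff_subset) (auto simp: q_def)
    ultimately have "card (seats D4) \<le> m - q"
      using D4(3) D1(4) by (metis card_mono finite_Diff)
    then have num4: "num_accepted (run A ?I4) + q \<le> 2 * n"
      using D4(1,2) D3(1,3,5) num2 ml q by simp
    \<comment> \<open>Offline gives each seat below \<open>m\<close> the pair \<open>(1, 2)\<close>,
      \<open>(2, 4)\<close> and each other seat the pair \<open>(3, 4)\<close>,
      \<open>(1, 3)\<close>, so nothing is rejected.\<close>
    have "valid_solution n ?I1 (map Some [0..<m])"
      using valid_solution_replicate_Some[of n "[]" "[]" "[0..<m]"] ml by simp
    then have "valid_solution n ?I2 (map Some [0..<m] @ map Some [m..<n])"
      using valid_solution_replicate_Some[of n ?I1 "map Some [0..<m]" "[m..<n]" "(3, 4)"] ml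
      by (simp add: fits_replicate overlap_iff l_def)
    then have "valid_solution n ?I3 ((map Some [0..<m] @ map Some [m..<n]) @ map Some [m..<n])"
      using valid_solution_replicate_Some[of n ?I2 "map Some [0..<m] @ map Some [m..<n]"
          "[m..<n]" "(1, 3)"] ml
      by (auto simp: fits_append fits_replicate overlap_iff l_def)
    then have "valid_solution n ?I4
        (((map Some [0..<m] @ map Some [m..<n]) @ map Some [m..<n]) @ map Some [0..<m])"
      using valid_solution_replicate_Some[of n ?I3
          "(map Some [0..<m] @ map Some [m..<n]) @ map Some [m..<n]" "[0..<m]" "(2, 4)"] ml
      by (auto simp: fits_append fits_replicate overlap_iff l_def)
    then have S: "valid_solution n ?I4 (map Some ([0..<m] @ [m..<n] @ [m..<n] @ [0..<m]))"
      by simp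
    show ?thesis
    proof (rule ratio_violated_of_lead[OF alg fair k _ _ S])
      show "?I4 \<in> inputs k"
        using in3 req by auto
      show "num_accepted (run A ?I4) + q \<le> length ?I4"
        using num4 ml by simp
      show "num_accepted (run A ?I4) + n \<le> 11 * q"
        using num4 2 by linarith
    qed (use c n q ml in auto)
  qed
qed

section \<open>The bound for all numbers of stations\<close>

theorem theorem13:
  fixes n k :: nat
  assumes "n \<ge> 2" and "k \<ge> 2"
  shows "\<not> (\<exists>A. online_algorithm n k A \<and> fair n k A \<and>
              online_bounded_ratio n k A > ereal (11 / (real k + 7)))"
proof
  assume "\<exists>A. online_algorithm n k A \<and> fair n k A \<and>
    online_bounded_ratio n k A > ereal (11 / (real k + 7))"
  \<comment> \<open>A supremum above the bound yields a single guaranteed factor \<open>c\<close>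
    above the bound.\<close>
  then obtain A c where A: "online_algorithm n k A" "fair n k A"
    and c: "c > 11 / (real k + 7)"
    and le: "\<forall>I \<in> inputs k. real (num_accepted (run A I)) \<ge> c * real (Opt n A I)"
    unfolding online_bounded_ratio_def less_Sup_iff by auto
  have "\<exists>J \<in> inputs k. real (num_accepted (run A J)) < c * real (Opt n A J)"
  proof (cases "k \<ge> 5")
    case True
    then show ?thesis
      using ratio_violated A assms c by blast
  next
    case False
    then have "1 \<le> 11 / (real k + 7)"
      by (simp add: field_simps)
    then have "1 < c"
      using c by linarith
    then show ?thesis
      using ratio_above_one_violated[OF A] assms by simp
  qed
  then show False
    using le by (meson not_less)
qed

end
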